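(* Let $g$ be a generic enumeration of $\mathcal{A}$, let $\mathcal{G}=g^{-1}(\mathcal{A})$ and let $D_\mathcal{G}$ be the atomic diagram of $\mathcal{G}$. Then for every computable $\mathbb{N}$-formula $\varphi$ in normal form, \[(\mathbb N,D_\mathcal{G})\models\varphi\iff\exists p\subset g\,[\,p\Vdash_\mathcal{A}\varphi\,].\]
   Context: Let $\tau$ be a countable relational vocabulary with $=,\neq$ and $\mathcal{A}$ a $\tau$-structure with universe $\omega$. Fix an effective enumeration $(\phi^{at}_n)$ of atomic $\tau$-formulas with free variables of $\phi^{at}_n$ among $x_0,\dots,x_n$; the atomic diagram of a structure $\mathcal{B}$ with universe $\omega$ is $D_\mathcal{B}=\{n:\mathcal{B}\models\phi^{at}_n[x_i\mapsto i]\}$. $g^{-1}(\mathcal{A})$ is the structure on $\omega$ with $R^{\mathcal{G}}(\bar a)$ iff $R^\mathcal{A}(g(\bar a))$. $\mathbb{N}$-formulas in normal form: built from atoms $\top,\bot,D(\mathbf n)$ without quantifiers, with $(\mathbb N,X)\models D(\mathbf n)$ iff $n\in X$; $\mathbb{N}$-$\Sigma^p_0$ = finite conjunctions of atoms; $\mathbb{N}$-$\Pi^p_0$ = finite disjunctions of negated atoms; $\mathbb{N}$-$\Sigma^p_1$/$\mathbb{N}$-$\Pi^p_1$ = countable disjunctions of $\mathbb{N}$-$\Sigma^p_0$ / conjunctions of $\mathbb{N}$-$\Pi^p_0$; for $\alpha\ge2$, $\mathbb{N}$-$\Sigma^p_\alpha$ = $\bigvee_i(\phi_i\wedge\theta_i)$,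 $\mathbb{N}$-$\Pi^p_\alpha$ = $\bigwedge_i(\phi_i\vee\theta_i)$, $\phi_i\in\mathbb{N}$-$\Sigma^p_{\beta_i}$, $\theta_i\in\mathbb{N}$-$\Pi^p_{\beta_i}$, $0<\beta_i<\alpha$. Computable $\mathbb{N}$-formulas are those given by indices (levels via notations in Kleene's $\mathcal O$, disjunctions/conjunctions over c.e. sets of indices). $neg(\varphi)$ swaps each atom with its negation and $\bigvee\leftrightarrow\bigwedge$, $\wedge\leftrightarrow\vee$ recursively. Forcing conditions: finite tuples $p=(p_0,\dots,p_{k-1})$ of distinct natural numbers, ordered by extension; $p\subset g$ means $p$ is an initial segment of $g$. Forcing $\Vdash_\mathcal{A}$: $p\Vdash\top$, $p\not\Vdash\bot$; $p\Vdash D(\mathbf n)$ iff all variables $x_i$ of $\phi^{at}_n$ satisfy $i<k$ and $\mathcal{A}\models\phi^{at}_n[x_i\mapsto p_i]$; a finite conjunction of atoms is forced iff each conjunct is; $\bigvee_i\phi_i\in\mathbb{N}$-$\Sigma^p_1$ is forced iff some $\phi_i$ is; $\bigvee_i(\phi_i\wedge\theta_i)\in\mathbb{N}$-$\Sigma^p_\alpha$ ($\alpha\ge2$) is forced iff for some $i$ both are forced; an $\mathbb{N}$-$\Pi^p_\alpha$ formula $\varphi$ is forced by $p$ iff no $q\supseteq p$ forces $neg(\varphi)$. A generic enumeration of $\mathcal{A}$ is a bijection $g:\omega\to\omega$ such that for every computable $\mathbb{N}$-formula $\varphi$ there is $p\subset g$ with $p\Vdash_\mathcal{A}\varphi$ or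 $p\Vdash_\mathcal{A}neg(\varphi)$. *)

theory Defs
  imports "HOL-Library.Nat_Bijection" "HOL-Library.Countable_Set_Type" "HOL-Library.Sublist"
begin

section \<open>Partial recursive functions\<close>

text \<open>Programs for the unary partial recursive functions; several arguments are passed through
  the Cantor pairing \<^const>\<open>prod_encode\<close>.\<close>

datatype prog =
    PZero | PSucc | PFst | PSnd
  | PPair prog prog
  | PComp prog prog
  | PRec prog prog
  | PMin prog

inductive evals :: "prog \<Rightarrow> nat \<Rightarrow> nat \<Rightarrow> bool" where
  zero: "evals PZero x 0"
| succ: "evals PSucc x (Suc x)"
| fst: "evals PFst (prod_encode (x, y)) x"
| snd: "evals PSnd (prod_encode (x, y)) y"
| pair: "evals c x y \<Longrightarrow> evals d x z \<Longrightarrow> evals (PPair c d) x (prod_encode (y, z))"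
| comp: "evals d x y \<Longrightarrow> evals c y z \<Longrightarrow> evals (PComp c d) x z"
| rec_zero: "evals c x y \<Longrightarrow> evals (PRec c d) (prod_encode (x, 0)) y"
| rec_Suc: "evals (PRec c d) (prod_encode (x, n)) y \<Longrightarrow>
    evals d (prod_encode (x, prod_encode (n, y))) z \<Longrightarrow>
    evals (PRec c d) (prod_encode (x, Suc n)) z"
| min: "evals c (prod_encode (x, n)) 0 \<Longrightarrow>
    (\<forall>m<n. \<exists>y. evals c (prod_encode (x, m)) (Suc y)) \<Longrightarrow> evals (PMin c) x n"

primrec prog_code :: "prog \<Rightarrow> nat" where
  "prog_code PZero = prod_encode (0, 0)"
| "prog_code PSucc = prod_encode (1, 0)"
| "prog_code PFst = prod_encode (2, 0)"
| "prog_code PSnd = prod_encode (3, 0)"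
| "prog_code (PPair c d) = prod_encode (4, prod_encode (prog_code c, prog_code d))"
| "prog_code (PComp c d) = prod_encode (5, prod_encode (prog_code c, prog_code d))"
| "prog_code (PRec c d) = prod_encode (6, prod_encode (prog_code c, prog_code d))"
| "prog_code (PMin c) = prod_encode (7, prog_code c)"

text \<open>The graph of the \<open>e\<close>-th partial recursive function (nowhere defined if \<open>e\<close> is not the code
  of a program), and the \<open>e\<close>-th c.e. set.\<close>

definition pr_graph :: "nat \<Rightarrow> nat \<Rightarrow> nat \<Rightarrow> bool" where
  "pr_graph e x y \<longleftrightarrow> (\<exists>c. prog_code c = e \<and> evals c x y)"

definition ce_set :: "nat \<Rightarrow> nat set" where
  "ce_set e = {x. \<exists>y. pr_graph e x y}"

definition computable_fun :: "(nat \<Rightarrow> nat) \<Rightarrow> bool" where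
  "computable_fun f \<longleftrightarrow> (\<exists>e. \<forall>x. pr_graph e x (f x))"

lemma prog_code_inject: "prog_code c = prog_code d \<longleftrightarrow> c = d"
proof (induction c arbitrary: d)
  case PZero then show ?case by (cases d) auto
next
  case PSucc then show ?case by (cases d) auto
next
  case PFst then show ?case by (cases d) auto
next
  case PSnd then show ?case by (cases d) auto
next
  case (PPair c1 c2) then show ?case by (cases d) auto
next
  case (PComp c1 c2) then show ?case by (cases d) auto
next
  case (PRec c1 c2) then show ?case by (cases d) auto
next
  case (PMin c) then show ?case by (cases d) auto
qed


section \<open>Kleene's \<open>\<O>\<close>\<close>

inductive kleene_O :: "nat \<Rightarrow> bool" and less_O :: "nat \<Rightarrow> nat \<Rightarrow> bool" where
  O_one: "kleene_O 1"
| O_suc: "kleene_O a \<Longrightarrow> kleene_O (2 ^ a)"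
| O_lim: "(\<And>n. pr_graph e n (f n)) \<Longrightarrow> (\<And>n. kleene_O (f n)) \<Longrightarrow>
    (\<And>n. less_O (f n) (f (Suc n))) \<Longrightarrow> kleene_O (3 * 5 ^ e)"
| less_suc: "kleene_O a \<Longrightarrow> less_O a (2 ^ a)"
| less_lim: "kleene_O (3 * 5 ^ e) \<Longrightarrow> pr_graph e n a \<Longrightarrow> less_O a (3 * 5 ^ e)"
| less_trans: "less_O a b \<Longrightarrow> less_O b c \<Longrightarrow> less_O a c"


section \<open>Structures and atomic diagrams\<close>

text \<open>Relation symbols are natural numbers; a vocabulary is a set \<open>Sym\<close> of symbols with an
  arity function \<open>ar\<close>. Equality and inequality are logical symbols of every vocabulary.\<close>

datatype atomic = AEq nat nat | ANeq nat nat | ARel nat "nat list"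

primrec wf_atomic :: "nat set \<Rightarrow> (nat \<Rightarrow> nat) \<Rightarrow> atomic \<Rightarrow> bool" where
  "wf_atomic Sym ar (AEq i j) \<longleftrightarrow> True"
| "wf_atomic Sym ar (ANeq i j) \<longleftrightarrow> True"
| "wf_atomic Sym ar (ARel R is) \<longleftrightarrow> R \<in> Sym \<and> length is = ar R"

primrec atomic_vars :: "atomic \<Rightarrow> nat set" where
  "atomic_vars (AEq i j) = {i, j}"
| "atomic_vars (ANeq i j) = {i, j}"
| "atomic_vars (ARel R is) = set is"

primrec atomic_code :: "atomic \<Rightarrow> nat" where
  "atomic_code (AEq i j) = prod_encode (0, prod_encode (i, j))"
| "atomic_code (ANeq i j) = prod_encode (1, prod_encode (i, j))"
| "atomic_code (ARel R is) = prod_encode (2, prod_encode (R, list_encode is))"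

definition effective_enum :: "nat set \<Rightarrow> (nat \<Rightarrow> nat) \<Rightarrow> (nat \<Rightarrow> atomic) \<Rightarrow> bool" where
  "effective_enum Sym ar atf \<longleftrightarrow>
     range atf = {\<phi>. wf_atomic Sym ar \<phi>} \<and>
     (\<forall>n. atomic_vars (atf n) \<subseteq> {0..n}) \<and>
     computable_fun (\<lambda>n. atomic_code (atf n))"

text \<open>A structure with universe \<open>\<omega>\<close> is given by the interpretation of its relation symbols; only
  tuples of the right length matter.\<close>

type_synonym struct = "nat \<Rightarrow> nat list \<Rightarrow> bool"

primrec sat_atomic :: "struct \<Rightarrow> (nat \<Rightarrow> nat) \<Rightarrow> atomic \<Rightarrow> bool" where
  "sat_atomic A v (AEq i j) \<longleftrightarrow> v i = v j"
| "sat_atomic A v (ANeq i j) \<longleftrightarrow> v i \<noteq> v j"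
| "sat_atomic A v (ARel R is) \<longleftrightarrow> A R (map v is)"

definition diagram :: "(nat \<Rightarrow> atomic) \<Rightarrow> struct \<Rightarrow> nat set" where
  "diagram atf B = {n. sat_atomic B (\<lambda>i. i) (atf n)}"

definition pullback :: "(nat \<Rightarrow> nat) \<Rightarrow> struct \<Rightarrow> struct" where
  "pullback g A = (\<lambda>R as. A R (map g as))"


section \<open>\<open>\<nat>\<close>-formulas in normal form\<close>

datatype natom = NTop | NBot | ND nat

text \<open>Raw syntax; the levels are imposed by the index predicates below. \<open>NegDisj0 ls\<close> is the
  disjunction of the negations of the atoms in \<open>ls\<close>. A pair \<open>(\<phi>, \<theta>)\<close> stands for
  \<open>\<phi> \<and> \<theta>\<close> inside \<open>Disj\<close> and for \<open>\<phi> \<or> \<theta>\<close> inside \<open>Conj\<close>; in both cases \<open>\<phi>\<close> is the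
  \<open>\<Sigma>\<close> component and \<open>\<theta>\<close> the \<open>\<Pi>\<close> component.\<close>

datatype nform =
    Conj0 "natom list"
  | NegDisj0 "natom list"
  | Disj1 "nform cset"
  | Conj1 "nform cset"
  | Disj "(nform \<times> nform) cset"
  | Conj "(nform \<times> nform) cset"

text \<open>The swap keeps the \<open>\<Sigma>\<close> component first: the negation of a \<open>\<Pi>\<close> formula is \<open>\<Sigma>\<close>.\<close>

primrec neg :: "nform \<Rightarrow> nform" where
  "neg (Conj0 ls) = NegDisj0 ls"
| "neg (NegDisj0 ls) = Conj0 ls"
| "neg (Disj1 F) = Conj1 (cimage neg F)"
| "neg (Conj1 F) = Disj1 (cimage neg F)"
| "neg (Disj F) = Conj (cimage prod.swap (cimage (map_prod neg neg) F))"
| "neg (Conj F) = Disj (cimage prod.swap (cimage (map_prod neg neg) F))"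

text \<open>Well-founded relations for the recursions below: \<open>subf\<close> is the immediate subformula
  relation up to negation, and \<open>neg_subf\<close> also puts \<open>neg \<phi>\<close> below a \<open>\<Pi>\<close> formula \<open>\<phi>\<close>.\<close>

fun children :: "nform \<Rightarrow> nform set" where
  "children (Conj0 ls) = {}"
| "children (NegDisj0 ls) = {}"
| "children (Disj1 F) = rcset F"
| "children (Conj1 F) = rcset F"
| "children (Disj F) = fst ` rcset F \<union> snd ` rcset F"
| "children (Conj F) = fst ` rcset F \<union> snd ` rcset F"

fun is_Pi :: "nform \<Rightarrow> bool" where
  "is_Pi (NegDisj0 ls) = True"
| "is_Pi (Conj1 F) = True"
| "is_Pi (Conj F) = True"
| "is_Pi _ = False"

definition subf :: "(nform \<times> nform) set" where
  "subf = {(\<psi>, \<phi>). \<psi> \<in> children \<phi> \<or> neg \<psi> \<in> children \<phi>}"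

definition neg_subf :: "(nform \<times> nform) set" where
  "neg_subf = subf \<union> {(neg \<phi>, \<phi>) |\<phi>. is_Pi \<phi>}"

lemma neg_neg [simp]: "neg (neg \<phi>) = \<phi>"
proof (induction \<phi>)
  case (Disj1 F) then show ?case by (simp add: cset.map_comp cset.map_ident_strong)
next
  case (Conj1 F) then show ?case by (simp add: cset.map_comp cset.map_ident_strong)
next
  case (Disj F)
  have "neg (neg (fst z)) = fst z \<and> neg (neg (snd z)) = snd z" if "z \<in> rcset F" for z
    using Disj[OF that] by (cases z) simp
  then have "cimage (\<lambda>z. prod.swap (map_prod neg neg (prod.swap (map_prod neg neg z)))) F = F"
    by (intro cset.map_ident_strong) (simp add: prod_eq_iff)
  then show ?case by (simp add: cset.map_comp comp_def)
next
  case (Conj F)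
  have "neg (neg (fst z)) = fst z \<and> neg (neg (snd z)) = snd z" if "z \<in> rcset F" for z
    using Conj[OF that] by (cases z) simp
  then have "cimage (\<lambda>z. prod.swap (map_prod neg neg (prod.swap (map_prod neg neg z)))) F = F"
    by (intro cset.map_ident_strong) (simp add: prod_eq_iff)
  then show ?case by (simp add: cset.map_comp comp_def)
qed simp_all

lemma children_neg: "children (neg \<phi>) = neg ` children \<phi>"
  by (cases \<phi>) (simp_all add: cset.set_map image_Un image_image Un_commute)

lemma subf_neg: "(\<psi>, neg \<phi>) \<in> subf \<longleftrightarrow> (\<psi>, \<phi>) \<in> subf"
proof -
  have "\<psi> \<in> neg ` S \<longleftrightarrow> neg \<psi> \<in> S" for \<psi> S
    by (metis image_iff neg_neg)
  then show ?thesis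
    by (auto simp: subf_def children_neg)
qed

lemma is_Pi_neg: "is_Pi (neg \<phi>) \<longleftrightarrow> \<not> is_Pi \<phi>"
  by (cases \<phi>) auto

lemma wf_neg_subf: "wf neg_subf"
proof -
  let ?A = "Wellfounded.acc neg_subf"
  have sigma: "\<phi> \<in> ?A" if "\<not> is_Pi \<phi>" "\<And>\<psi>. (\<psi>, \<phi>) \<in> subf \<Longrightarrow> \<psi> \<in> ?A" for \<phi>
    by (rule accI) (use that in \<open>auto simp: neg_subf_def\<close>)
  have step: "\<phi> \<in> ?A" if sub: "\<And>\<psi>. (\<psi>, \<phi>) \<in> subf \<Longrightarrow> \<psi> \<in> ?A" for \<phi>
  proof (cases "is_Pi \<phi>")
    case True
    have n: "neg \<phi> \<in> ?A"
      by (rule sigma) (use True sub in \<open>simp_all add: is_Pi_neg subf_neg\<close>)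
    show ?thesis
      by (rule accI) (use sub n in \<open>auto simp: neg_subf_def\<close>)
  next
    case False
    show ?thesis by (rule sigma) (use False sub in simp_all)
  qed
  have main: "\<phi> \<in> ?A \<and> neg \<phi> \<in> ?A"
    if ch: "\<And>\<psi>. \<psi> \<in> children \<phi> \<Longrightarrow> \<psi> \<in> ?A \<and> neg \<psi> \<in> ?A" for \<phi>
  proof -
    have sub: "\<psi> \<in> ?A" if "(\<psi>, \<phi>) \<in> subf" for \<psi>
      using that ch[of \<psi>] ch[of "neg \<psi>"] by (auto simp: subf_def)
    show ?thesis
      using step[of \<phi>] step[of "neg \<phi>"] sub by (simp add: subf_neg)
  qed
  have "\<phi> \<in> ?A \<and> neg \<phi> \<in> ?A" for \<phi>
  proof (induction \<phi>)
    case (Conj0 ls) show ?case by (rule main) simp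
  next
    case (NegDisj0 ls) show ?case by (rule main) simp
  next
    case (Disj1 F) show ?case by (rule main) (use Disj1 in simp)
  next
    case (Conj1 F) show ?case by (rule main) (use Conj1 in simp)
  next
    case (Disj F)
    have X: "\<psi> \<in> ?A \<and> neg \<psi> \<in> ?A" if "\<psi> = fst z \<or> \<psi> = snd z" "z \<in> rcset F" for z \<psi>
      using that Disj[OF that(2)] by (cases z) auto
    show ?case by (rule main) (use X in auto)
  next
    case (Conj F)
    have X: "\<psi> \<in> ?A \<and> neg \<psi> \<in> ?A" if "\<psi> = fst z \<or> \<psi> = snd z" "z \<in> rcset F" for z \<psi>
      using that Conj[OF that(2)] by (cases z) auto
    show ?case by (rule main) (use X in auto)
  qed
  then show ?thesis by (intro acc_wfI) simp
qed

lemma children_neg_subf: "\<phi> \<in> children \<psi> \<Longrightarrow> (\<phi>, \<psi>) \<in> neg_subf"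
  by (simp add: neg_subf_def subf_def)

lemma pair_neg_subf:
  assumes "z \<in> rcset P" and "(\<phi>, \<theta>) = z"
  shows "(\<phi>, Disj P) \<in> neg_subf" "(\<theta>, Disj P) \<in> neg_subf"
    "(\<phi>, Conj P) \<in> neg_subf" "(\<theta>, Conj P) \<in> neg_subf"
proof -
  have "\<phi> \<in> fst ` rcset P"
    using assms by (metis fst_conv image_eqI)
  moreover have "\<theta> \<in> snd ` rcset P"
    using assms by (metis snd_conv image_eqI)
  ultimately show "(\<phi>, Disj P) \<in> neg_subf" "(\<theta>, Disj P) \<in> neg_subf"
    "(\<phi>, Conj P) \<in> neg_subf" "(\<theta>, Conj P) \<in> neg_subf"
    by (simp_all add: children_neg_subf)
qed

lemma Pi_neg_subf: "is_Pi \<psi> \<Longrightarrow> (neg \<psi>, \<psi>) \<in> neg_subf"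
  unfolding neg_subf_def by blast

primrec sat_natom :: "nat set \<Rightarrow> natom \<Rightarrow> bool" where
  "sat_natom X NTop \<longleftrightarrow> True"
| "sat_natom X NBot \<longleftrightarrow> False"
| "sat_natom X (ND n) \<longleftrightarrow> n \<in> X"

function sat :: "nat set \<Rightarrow> nform \<Rightarrow> bool" where
  "sat X (Conj0 ls) \<longleftrightarrow> (\<forall>l\<in>set ls. sat_natom X l)"
| "sat X (NegDisj0 ls) \<longleftrightarrow> (\<exists>l\<in>set ls. \<not> sat_natom X l)"
| "sat X (Disj1 F) \<longleftrightarrow> (\<exists>\<phi>\<in>rcset F. sat X \<phi>)"
| "sat X (Conj1 F) \<longleftrightarrow> (\<forall>\<phi>\<in>rcset F. sat X \<phi>)"
| "sat X (Disj F) \<longleftrightarrow> (\<exists>(\<phi>, \<theta>)\<in>rcset F. sat X \<phi> \<and> sat X \<theta>)"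
| "sat X (Conj F) \<longleftrightarrow> (\<forall>(\<phi>, \<theta>)\<in>rcset F. sat X \<phi> \<or> sat X \<theta>)"
  by pat_completeness auto
termination
proof (relation "inv_image neg_subf snd", goal_cases)
  case 1
  show ?case by (simp add: wf_neg_subf)
qed (simp_all only: in_inv_image snd_conv, (rule children_neg_subf; simp; fail
      | erule (1) pair_neg_subf)+)


section \<open>Computable \<open>\<nat>\<close>-formulas\<close>

fun natom_of :: "nat \<Rightarrow> natom" where
  "natom_of 0 = NTop"
| "natom_of (Suc 0) = NBot"
| "natom_of (Suc (Suc n)) = ND n"

text \<open>\<open>Sigma_index a e \<phi>\<close>: \<open>\<phi>\<close> is the computable \<open>\<Sigma>\<close> formula with index \<open>e\<close> at the level denoted by
  \<open>a \<in> \<O>\<close>; similarly for \<open>\<Pi>\<close>. The numbers \<open>1\<close> and \<open>2\<close> are the unique notations of the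
  ordinals 0 and 1, so \<open>b \<noteq> 1\<close> says that the level denoted by \<open>b\<close> is positive. At level 0,
  \<open>e\<close> codes a finite list of atoms. At higher levels, the elements of the \<open>e\<close>-th c.e. set are
  the indices of the disjuncts (conjuncts).\<close>

inductive Sigma_index :: "nat \<Rightarrow> nat \<Rightarrow> nform \<Rightarrow> bool"
  and Pi_index :: "nat \<Rightarrow> nat \<Rightarrow> nform \<Rightarrow> bool" where
  Sigma0: "Sigma_index 1 e (Conj0 (map natom_of (list_decode e)))"
| Pi0: "Pi_index 1 e (NegDisj0 (map natom_of (list_decode e)))"
| Sigma1: "Sigma_index 2 e (Disj1 F)"
  if "\<forall>i\<in>ce_set e. \<exists>\<phi>\<in>rcset F. Sigma_index 1 i \<phi>"
    and "\<forall>\<phi>\<in>rcset F. \<exists>i\<in>ce_set e. Sigma_index 1 i \<phi>"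
| Pi1: "Pi_index 2 e (Conj1 F)"
  if "\<forall>i\<in>ce_set e. \<exists>\<phi>\<in>rcset F. Pi_index 1 i \<phi>"
    and "\<forall>\<phi>\<in>rcset F. \<exists>i\<in>ce_set e. Pi_index 1 i \<phi>"
| Sigma: "Sigma_index a e (Disj F)"
  if "kleene_O a" "a \<noteq> 1" "a \<noteq> 2"
    and "\<forall>u\<in>ce_set e. \<exists>(\<phi>, \<theta>)\<in>rcset F. \<exists>b i j. u = prod_encode (b, prod_encode (i, j)) \<and>
           less_O b a \<and> b \<noteq> 1 \<and> Sigma_index b i \<phi> \<and> Pi_index b j \<theta>"
    and "\<forall>(\<phi>, \<theta>)\<in>rcset F. \<exists>u\<in>ce_set e. \<exists>b i j. u = prod_encode (b, prod_encode (i, j)) \<and>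
           less_O b a \<and> b \<noteq> 1 \<and> Sigma_index b i \<phi> \<and> Pi_index b j \<theta>"
| Pi: "Pi_index a e (Conj F)"
  if "kleene_O a" "a \<noteq> 1" "a \<noteq> 2"
    and "\<forall>u\<in>ce_set e. \<exists>(\<phi>, \<theta>)\<in>rcset F. \<exists>b i j. u = prod_encode (b, prod_encode (i, j)) \<and>
           less_O b a \<and> b \<noteq> 1 \<and> Sigma_index b i \<phi> \<and> Pi_index b j \<theta>"
    and "\<forall>(\<phi>, \<theta>)\<in>rcset F. \<exists>u\<in>ce_set e. \<exists>b i j. u = prod_encode (b, prod_encode (i, j)) \<and>
           less_O b a \<and> b \<noteq> 1 \<and> Sigma_index b i \<phi> \<and> Pi_index b j \<theta>"

definition computable_nform :: "nform \<Rightarrow> bool" where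
  "computable_nform \<phi> \<longleftrightarrow> (\<exists>a e. Sigma_index a e \<phi> \<or> Pi_index a e \<phi>)"


section \<open>Forcing\<close>

text \<open>Conditions are the distinct lists of natural numbers.\<close>

fun forces_natom :: "(nat \<Rightarrow> atomic) \<Rightarrow> struct \<Rightarrow> nat list \<Rightarrow> natom \<Rightarrow> bool" where
  "forces_natom atf A p NTop \<longleftrightarrow> True"
| "forces_natom atf A p NBot \<longleftrightarrow> False"
| "forces_natom atf A p (ND n) \<longleftrightarrow>
     (\<forall>i\<in>atomic_vars (atf n). i < length p) \<and> sat_atomic A (\<lambda>i. p ! i) (atf n)"

function forces :: "(nat \<Rightarrow> atomic) \<Rightarrow> struct \<Rightarrow> nat list \<Rightarrow> nform \<Rightarrow> bool" where
  "forces atf A p (Conj0 ls) \<longleftrightarrow> (\<forall>l\<in>set ls. forces_natom atf A p l)"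
| "forces atf A p (Disj1 F) \<longleftrightarrow> (\<exists>\<phi>\<in>rcset F. forces atf A p \<phi>)"
| "forces atf A p (Disj F) \<longleftrightarrow> (\<exists>(\<phi>, \<theta>)\<in>rcset F. forces atf A p \<phi> \<and> forces atf A p \<theta>)"
| "forces atf A p (NegDisj0 ls) \<longleftrightarrow>
     \<not> (\<exists>q. distinct q \<and> prefix p q \<and> forces atf A q (neg (NegDisj0 ls)))"
| "forces atf A p (Conj1 F) \<longleftrightarrow>
     \<not> (\<exists>q. distinct q \<and> prefix p q \<and> forces atf A q (neg (Conj1 F)))"
| "forces atf A p (Conj F) \<longleftrightarrow>
     \<not> (\<exists>q. distinct q \<and> prefix p q \<and> forces atf A q (neg (Conj F)))"
  by pat_completeness auto
termination
proof (relation "inv_image neg_subf (\<lambda>(atf, A, p, \<phi>). \<phi>)", goal_cases)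
  case 1
  show ?case by (simp add: wf_neg_subf)
qed (simp_all only: in_inv_image prod.case, (rule children_neg_subf; simp; fail
      | erule (1) pair_neg_subf | rule Pi_neg_subf; simp; fail)+)

definition initial_segment :: "nat list \<Rightarrow> (nat \<Rightarrow> nat) \<Rightarrow> bool" where
  "initial_segment p g \<longleftrightarrow> (\<forall>i<length p. p ! i = g i)"

definition generic_enumeration :: "(nat \<Rightarrow> atomic) \<Rightarrow> struct \<Rightarrow> (nat \<Rightarrow> nat) \<Rightarrow> bool" where
  "generic_enumeration atf A g \<longleftrightarrow> bij g \<and>
     (\<forall>\<phi>. computable_nform \<phi> \<longrightarrow>
        (\<exists>p. distinct p \<and> initial_segment p g \<and> (forces atf A p \<phi> \<or> forces atf A p (neg \<phi>))))"

end

(* Truth and forcing agree on a Sigma formula as soon as they agree on its immediate subformulas,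
   because the initial segments of g form a chain and forcing is monotone. On a Pi formula they
   agree if they agree on its negation and g decides the formula. Genericity decides a formula and
   its negation at once, so the induction carries both along the subformulas of a computable
   formula; computability of negations is never needed. *)

theory Submission
  imports Defs
begin

lemma sat_neg: "sat X (neg \<phi>) \<longleftrightarrow> \<not> sat X \<phi>"
proof (induction \<phi>)
  case (Disj F)
  \<comment> \<open>The induction hypothesis ranges over the component sets of the pair
    \<open>z\<close>; splitting \<open>z\<close> turns it into facts about \<open>fst z\<close> and
    \<open>snd z\<close>.\<close>
  have "sat X (neg (fst z)) \<longleftrightarrow> \<not> sat X (fst z)" "sat X (neg (snd z)) \<longleftrightarrow> \<not> sat X (snd z)"
    if "z \<in> rcset F" for z
    using Disj[OF that] by (cases z; simp)+
  then show ?case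
    by (auto simp: cset.set_map case_prod_unfold)
next
  case (Conj F)
  have "sat X (neg (fst z)) \<longleftrightarrow> \<not> sat X (fst z)" "sat X (neg (snd z)) \<longleftrightarrow> \<not> sat X (snd z)"
    if "z \<in> rcset F" for z
    using Conj[OF that] by (cases z; simp)+
  then show ?case
    by (auto simp: cset.set_map case_prod_unfold)
qed (simp_all add: cset.set_map)

text \<open>Unites the three \<Pi> clauses of \<open>forces\<close>, so that later arguments need no
  case split. Keeping \<open>neg\<close> folded lets the clauses match literally.\<close>

lemma forces_Pi:
  assumes "is_Pi \<phi>"
  shows "forces atf A p \<phi> \<longleftrightarrow> \<not> (\<exists>q. distinct q \<and> prefix p q \<and> forces atf A q (neg \<phi>))"
  using assms by (cases \<phi>) (simp_all del: neg.simps)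

lemma sat_atomic_cong:
  assumes "\<And>i. i \<in> atomic_vars a \<Longrightarrow> v i = w i"
  shows "sat_atomic A v a \<longleftrightarrow> sat_atomic A w a"
  using assms by (cases a) (auto cong: map_cong)

lemma prefix_nth: "prefix p q \<Longrightarrow> i < length p \<Longrightarrow> q ! i = p ! i"
  by (auto simp: prefix_def nth_append)

text \<open>Forcing \<open>ND n\<close> bounds its variables by the length of \<open>p\<close>, so
  an extension evaluates the atom at the same entries and \<open>!\<close> is never read out of
  range.\<close>

lemma forces_natom_mono:
  assumes "prefix p q" "forces_natom atf A p l"
  shows "forces_natom atf A q l"
proof (cases l)
  case (ND n)
  have "sat_atomic A (\<lambda>i. q ! i) (atf n) \<longleftrightarrow> sat_atomic A (\<lambda>i. p ! i) (atf n)"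
    by (rule sat_atomic_cong) (use assms ND in \<open>auto simp: prefix_nth\<close>)
  with ND assms show ?thesis
    using prefix_length_le by fastforce
qed (use assms in auto)

lemma forces_mono:
  assumes "prefix p q" "forces atf A p \<phi>"
  shows "forces atf A q \<phi>"
proof -
  \<comment> \<open>No induction here: every extension of \<open>q\<close> already extends
    \<open>p\<close>, so none can force the negation.\<close>
  have Pi: "forces atf A q \<psi>" if "is_Pi \<psi>" "forces atf A p \<psi>" for \<psi>
    using that assms(1) unfolding forces_Pi[OF that(1)]
    by (blast intro: prefix_order.order_trans)
  from assms(2) show ?thesis
  proof (induction \<phi>)
    case (Conj0 ls)
    then show ?case using forces_natom_mono[OF assms(1)] by auto
  next
    case (Disj1 F)
    then show ?case by auto
  next
    case (Disj F)
    from Disj.prems obtain \<phi> \<theta> where z: "(\<phi>, \<theta>) \<in> rcset F" "forces atf A p \<phi>" "forces atf A p \<theta>"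
      by auto
    with Disj.IH[OF z(1)] have "forces atf A q \<phi>" "forces atf A q \<theta>" by auto
    with z(1) show ?case by auto
  qed (simp_all add: Pi del: forces.simps)
qed

text \<open>One of the two formulas is \<Pi>; its clause, applied to \<open>p\<close> as an
  extension of itself, excludes the other. Distinctness makes \<open>p\<close> an admissible
  extension.\<close>

lemma forces_consistent:
  assumes "distinct p"
  shows "\<not> (forces atf A p \<phi> \<and> forces atf A p (neg \<phi>))"
proof (cases "is_Pi \<phi>")
  case True
  with assms show ?thesis
    using forces_Pi[OF True] by blast
next
  case False
  then have "is_Pi (neg \<phi>)" by (simp add: is_Pi_neg)
  from forces_Pi[OF this] assms show ?thesis
    unfolding neg_neg by blast
qed

lemma initial_segment_chain:
  assumes "initial_segment p g" "initial_segment q g"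
  shows "prefix p q \<or> prefix q p"
proof -
  \<comment> \<open>An initial segment is determined by its length, so comparing two of them reduces
    to comparing lengths.\<close>
  have *: "map g [0..<length r] = r" if "initial_segment r g" for r
    using that by (intro nth_equalityI) (simp_all add: initial_segment_def)
  have "prefix (map g [0..<m]) (map g [0..<n])" if "m \<le> n" for m n
    using that upt_add_eq_append[of 0 m "n - m"] by simp
  then have "prefix (map g [0..<length p]) (map g [0..<length q]) \<or>
      prefix (map g [0..<length q]) (map g [0..<length p])"
    using nat_le_linear by blast
  then show ?thesis
    by (simp only: *[OF assms(1)] *[OF assms(2)])
qed

lemma distinct_initial_segment:
  assumes "inj g" "initial_segment p g"
  shows "distinct p"
  using assms by (auto simp: initial_segment_def distinct_conv_nth inj_eq)

lemma initial_segment_map: "initial_segment (map g [0..<n]) g"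
  by (simp add: initial_segment_def)

text \<open>Relations agree by definition of the pullback; injectivity serves equality and
  inequality, which compare \<open>i, j\<close> on one side and \<open>g i, g j\<close> on the
  other.\<close>

lemma sat_atomic_pullback:
  assumes "inj g"
  shows "sat_atomic (pullback g A) (\<lambda>i. i) a \<longleftrightarrow> sat_atomic A g a"
  using assms by (cases a) (auto simp: pullback_def inj_eq)

definition truth_forced :: "(nat \<Rightarrow> atomic) \<Rightarrow> struct \<Rightarrow> (nat \<Rightarrow> nat) \<Rightarrow> nform \<Rightarrow> bool" where
  "truth_forced atf A g \<phi> \<longleftrightarrow>
     (sat (diagram atf (pullback g A)) \<phi> \<longleftrightarrow>
       (\<exists>p. distinct p \<and> initial_segment p g \<and> forces atf A p \<phi>))"

lemma sat_natom_eq_forces_natom: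
  assumes "inj g" "initial_segment p g" "\<forall>n. l = ND n \<longrightarrow> (\<forall>i\<in>atomic_vars (atf n). i < length p)"
  shows "sat_natom (diagram atf (pullback g A)) l \<longleftrightarrow> forces_natom atf A p l"
proof (cases l)
  case (ND n)
  have "sat_atomic A (\<lambda>i. p ! i) (atf n) \<longleftrightarrow> sat_atomic A g (atf n)"
    by (rule sat_atomic_cong) (use assms ND in \<open>auto simp: initial_segment_def\<close>)
  with ND assms show ?thesis
    by (simp add: diagram_def sat_atomic_pullback)
qed auto

lemma finite_atomic_vars: "finite (atomic_vars a)"
  by (cases a) auto

lemma truth_forced_Conj0:
  assumes "inj g"
  shows "truth_forced atf A g (Conj0 ls)"
proof -
  let ?X = "diagram atf (pullback g A)"
  let ?V = "\<Union>n\<in>{n. ND n \<in> set ls}. atomic_vars (atf n)"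
  have "{n. ND n \<in> set ls} = ND -` set ls" by auto
  then have "finite ?V"
    by (auto intro!: finite_atomic_vars finite_vimageI simp: inj_def)
  \<comment> \<open>Finitely many atoms mention finitely many variables, so the single segment of
    length \<open>m\<close> is long enough to evaluate every conjunct.\<close>
  then obtain m where m: "\<forall>i\<in>?V. i < m"
    using finite_nat_set_iff_bounded by blast
  let ?p = "map g [0..<m]"
  have seg: "initial_segment ?p g" by (rule initial_segment_map)
  have "sat_natom ?X l \<longleftrightarrow> forces_natom atf A ?p l" if "l \<in> set ls" for l
    by (rule sat_natom_eq_forces_natom[OF assms seg]) (use m that in auto)
  \<comment> \<open>For the converse any segment will do, since a forced \<open>ND n\<close>
    supplies the length condition itself.\<close>
  moreover have "sat_natom ?X l" if "initial_segment p g" "forces_natom atf A p l" for p l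
    using that sat_natom_eq_forces_natom[OF assms that(1), of l atf A]
    by (cases l) auto
  ultimately show ?thesis
    using seg distinct_initial_segment[OF assms seg] unfolding truth_forced_def by fastforce
qed

lemma truth_forced_Sigma:
  assumes "inj g" "\<not> is_Pi \<phi>" "\<And>\<psi>. \<psi> \<in> children \<phi> \<Longrightarrow> truth_forced atf A g \<psi>"
  shows "truth_forced atf A g \<phi>"
proof (cases \<phi>)
  case (Conj0 ls)
  then show ?thesis using truth_forced_Conj0[OF assms(1)] by simp
next
  case (Disj1 F)
  then show ?thesis using assms(3) unfolding truth_forced_def by auto
next
  case (Disj F)
  let ?X = "diagram atf (pullback g A)"
  let ?P = "\<lambda>\<psi>. \<exists>p. distinct p \<and> initial_segment p g \<and> forces atf A p \<psi>"
  \<comment> \<open>Separate witnesses for the two components are comparable, and the longer one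
    forces both.\<close>
  have both: "?P \<psi> \<and> ?P \<theta> \<longleftrightarrow>
      (\<exists>p. distinct p \<and> initial_segment p g \<and> forces atf A p \<psi> \<and> forces atf A p \<theta>)"
    for \<psi> \<theta>
    using initial_segment_chain forces_mono by meson
  have ch: "sat ?X \<psi> \<longleftrightarrow> ?P \<psi>" if "\<psi> \<in> children \<phi>" for \<psi>
    using assms(3)[OF that] by (simp add: truth_forced_def)
  have "sat ?X (Disj F) \<longleftrightarrow> (\<exists>z\<in>rcset F. sat ?X (fst z) \<and> sat ?X (snd z))"
    by (simp add: case_prod_unfold)
  also have "\<dots> \<longleftrightarrow> (\<exists>z\<in>rcset F. ?P (fst z) \<and> ?P (snd z))"
    by (rule bex_cong[OF refl]) (simp only: ch Disj children.simps UnI1 UnI2 imageI)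
  also have "\<dots> \<longleftrightarrow> ?P (Disj F)"
    unfolding both forces.simps case_prod_unfold by blast
  finally show ?thesis
    using Disj by (simp add: truth_forced_def)
qed (use assms(2) in auto)

text \<open>If the formula is false, no segment forces it, so the deciding segment forces its
  negation. If it is true, a segment forcing the negation would be comparable with one forcing the
  formula, against consistency.\<close>

lemma truth_forced_neg:
  assumes "truth_forced atf A g \<phi>"
    and "\<exists>p. distinct p \<and> initial_segment p g \<and> (forces atf A p \<phi> \<or> forces atf A p (neg \<phi>))"
  shows "truth_forced atf A g (neg \<phi>)"
proof -
  have "\<not> (forces atf A p \<phi> \<and> forces atf A q (neg \<phi>))"
    if "distinct p" "distinct q" "initial_segment p g" "initial_segment q g" for p q
    using that initial_segment_chain[of p g q] forces_mono[of p q] forces_mono[of q p]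
      forces_consistent by metis
  with assms show ?thesis
    unfolding truth_forced_def sat_neg by blast
qed

text \<open>Inverting the index predicates exhibits an index for each immediate subformula, which
  makes genericity applicable to it.\<close>

lemma computable_children:
  assumes "computable_nform \<phi>" "\<psi> \<in> children \<phi>"
  shows "computable_nform \<psi>"
proof -
  from assms(1) obtain a e where "Sigma_index a e \<phi> \<or> Pi_index a e \<phi>"
    unfolding computable_nform_def by blast
  then show ?thesis
  proof
    assume "Sigma_index a e \<phi>"
    then show ?thesis
      by cases (use assms(2) in \<open>simp_all add: computable_nform_def case_prod_unfold, blast+\<close>)
  next
    assume "Pi_index a e \<phi>"
    then show ?thesis
      by cases (use assms(2) in \<open>simp_all add: computable_nform_def case_prod_unfold, blast+\<close>)
  qed
qed

lemma truth_forced_generic: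
  assumes "generic_enumeration atf A g" "computable_nform \<phi>"
  shows "truth_forced atf A g \<phi> \<and> truth_forced atf A g (neg \<phi>)"
  using assms(2)
proof (induction \<phi> rule: wf_induct_rule[OF wf_neg_subf])
  case (1 \<phi>)
  have inj: "inj g"
    using assms(1) by (simp add: generic_enumeration_def bij_is_inj)
  have dec: "\<exists>p. distinct p \<and> initial_segment p g \<and> (forces atf A p \<phi> \<or> forces atf A p (neg \<phi>))"
    using assms(1) "1.prems" by (simp add: generic_enumeration_def)
  \<comment> \<open>Only children enter the induction hypothesis, although \<open>neg_subf\<close>
    relates more formulas.\<close>
  have ch: "truth_forced atf A g \<psi> \<and> truth_forced atf A g (neg \<psi>)" if "\<psi> \<in> children \<phi>" for \<psi>
    using "1.IH"[OF children_neg_subf[OF that] computable_children[OF "1.prems" that]] .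
  show ?case
  proof (cases "is_Pi \<phi>")
    case False
    then have "truth_forced atf A g \<phi>"
      by (rule truth_forced_Sigma[OF inj]) (simp add: ch)
    with truth_forced_neg[OF this dec] show ?thesis by blast
  next
    case True
    then have "\<not> is_Pi (neg \<phi>)" by (simp add: is_Pi_neg)
    \<comment> \<open>The children of \<open>neg \<phi>\<close> are the negated children of
      \<open>\<phi>\<close>, which is where the second half of the hypothesis is spent.\<close>
    then have T: "truth_forced atf A g (neg \<phi>)"
      by (rule truth_forced_Sigma[OF inj]) (use ch in \<open>auto simp only: children_neg\<close>)
    \<comment> \<open>Deciding \<open>\<phi>\<close> also decides \<open>neg \<phi>\<close>, so
      passing to the negation once more returns to \<open>\<phi>\<close>.\<close>
    have "truth_forced atf A g (neg (neg \<phi>))"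
      by (rule truth_forced_neg[OF T]) (use dec in \<open>simp only: neg_neg disj_commute\<close>)
    with T show ?thesis by (simp only: neg_neg)
  qed
qed

theorem mainTheorem10:
  fixes Sym :: "nat set" and ar :: "nat \<Rightarrow> nat" and atf :: "nat \<Rightarrow> atomic"
    and A :: struct and g :: "nat \<Rightarrow> nat" and \<phi> :: nform
  assumes "effective_enum Sym ar atf"
    and "generic_enumeration atf A g"
    and "computable_nform \<phi>"
  shows "sat (diagram atf (pullback g A)) \<phi> \<longleftrightarrow>
    (\<exists>p. distinct p \<and> initial_segment p g \<and> forces atf A p \<phi>)"
  using truth_forced_generic[OF assms(2,3)] unfolding truth_forced_def by blast

end
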